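(* Let $p$ be a prime and let $E\in\mathcal{S}_p$ (respectively $E\in\mathcal{S}_p^{*}$) with $BD(E)=s$. Then for every $\delta>0$ there exist, for each $n\ge1$, a number $k_n$ and arithmetic progressions $A^{(n)}_1,\dots,A^{(n)}_{k_n}$ in $\mathbb{Z}$ (respectively in $\mathbb{N}$) of common difference $p^n$ such that $k_n\le p^{n(s+\delta)}$ for all $n$ large enough, $$E\subset\bigcup_{i=1}^{k_n}A^{(n)}_i,\qquad \bigcup_{i=1}^{k_{n+1}}A^{(n+1)}_i\subset\bigcup_{i=1}^{k_n}A^{(n)}_i\quad\text{for all }n\ge1,$$ and $$E=\bigcap_{n\ge1}\bigcup_{i=1}^{k_n}A^{(n)}_i.$$
   Context: $\mathbb{Z}_p$ is the ring of $p$-adic integers with metric $|x-y|_p$; $\overline{E}^p$ denotes the closure in $\mathbb{Z}_p$ of $E\subset\mathbb{Z}\subset\mathbb{Z}_p$; $\mathbb{N}=\{1,2,3,\dots\}$. Define $\mathcal{S}_p=\{E\subset\mathbb{Z}: E=\overline{E}^p\cap\mathbb{Z}\}$ and $\mathcal{S}_p^{*}=\{E\subset\mathbb{N}: E=\overline{E}^p\cap\mathbb{N}\}$. $BD(E)=\limsup_{n\to\infty}\frac{\log N_{p^{-n}}(E)}{n\log p}$ is the upper box-counting dimension of $E$ as a subset of $\mathbb{Z}_p$, where $N_{p^{-n}}(E)$ is the minimum number of balls of radius $p^{-n}$ needed to cover $E$. An arithmetic progression in $\mathbb{Z}$ of common difference $r$ is here a set $\{a+rm: m\in\mathbb{Z}\}$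 with $a\in\mathbb{Z}$; an arithmetic progression in $\mathbb{N}$ of common difference $r$ is here a set $\{a+rm: m\in\mathbb{Z}\}\cap\mathbb{N}$. *)

theory Defs
  imports "HOL-Analysis.Analysis" "HOL-Computational_Algebra.Primes"
begin

text \<open>
  The ring of \<open>p\<close>-adic integers is the inverse limit of the rings of integers modulo \<open>p ^ n\<close>: the
  coordinate \<open>x n\<close> is the representative of \<open>x\<close> modulo \<open>p ^ n\<close> in \<open>{0..<p ^ n}\<close>. Only the additive
  structure enters the metric.
\<close>

definition padic_ints :: "nat \<Rightarrow> (nat \<Rightarrow> int) set" where
  "padic_ints p = {x. \<forall>n. x n \<in> {0..<int p ^ n} \<and> x (Suc n) mod int p ^ n = x n}"

definition padic_of_int :: "nat \<Rightarrow> int \<Rightarrow> (nat \<Rightarrow> int)" where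
  "padic_of_int p a = (\<lambda>n. a mod int p ^ n)"

definition padic_diff :: "nat \<Rightarrow> (nat \<Rightarrow> int) \<Rightarrow> (nat \<Rightarrow> int) \<Rightarrow> (nat \<Rightarrow> int)" where
  "padic_diff p x y = (\<lambda>n. (x n - y n) mod int p ^ n)"

text \<open>
  As \<open>p ^ n\<close> divides \<open>x\<close> iff \<open>x n = 0\<close>, the valuation of a nonzero \<open>x\<close> is the least \<open>n\<close> with
  \<open>x (Suc n) \<noteq> 0\<close>.
\<close>

definition padic_val :: "(nat \<Rightarrow> int) \<Rightarrow> nat" where
  "padic_val x = (LEAST n. x (Suc n) \<noteq> 0)"

definition padic_norm :: "nat \<Rightarrow> (nat \<Rightarrow> int) \<Rightarrow> real" where
  "padic_norm p x = (if x = (\<lambda>_. 0) then 0 else 1 / real p ^ padic_val x)"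

definition padic_dist :: "nat \<Rightarrow> (nat \<Rightarrow> int) \<Rightarrow> (nat \<Rightarrow> int) \<Rightarrow> real" where
  "padic_dist p x y = padic_norm p (padic_diff p x y)"

definition padic_closure :: "nat \<Rightarrow> int set \<Rightarrow> (nat \<Rightarrow> int) set" where
  "padic_closure p E =
     Metric_space.mtopology (padic_ints p) (padic_dist p) closure_of (padic_of_int p ` E)"

definition S_padic :: "nat \<Rightarrow> int set set" where
  "S_padic p = {E. E = padic_of_int p -` padic_closure p E}"

definition S_padic_star :: "nat \<Rightarrow> int set set" where
  "S_padic_star p = {E. E \<subseteq> {1..} \<and> E = padic_of_int p -` padic_closure p E \<inter> {1..}}"

definition covering_number :: "'a set \<Rightarrow> ('a \<Rightarrow> 'a \<Rightarrow> real) \<Rightarrow> real \<Rightarrow> 'a set \<Rightarrow> nat" where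
  "covering_number M d r S =
     (LEAST k. \<exists>\<B>. \<B> \<subseteq> (\<lambda>c. Metric_space.mcball M d c r) ` M \<and> finite \<B> \<and> card \<B> = k \<and> S \<subseteq> \<Union>\<B>)"

text \<open>Since \<open>ln 0 = 0\<close>, the empty set gets dimension \<open>0\<close>.\<close>

definition box_dim :: "nat \<Rightarrow> int set \<Rightarrow> ereal" where
  "box_dim p E =
     limsup (\<lambda>n. ereal
       (ln (real (covering_number (padic_ints p) (padic_dist p) (1 / real p ^ n) (padic_of_int p ` E)))
         / (real n * ln (real p))))"

definition arith_prog_int :: "int \<Rightarrow> int set \<Rightarrow> bool" where
  "arith_prog_int r A \<longleftrightarrow> (\<exists>a. A = {a + r * m | m. True})"

definition arith_prog_nat :: "int \<Rightarrow> int set \<Rightarrow> bool" where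
  "arith_prog_nat r A \<longleftrightarrow> (\<exists>a. A = {a + r * m | m. True} \<inter> {1..})"

lemma padic_of_int_in_padic_ints:
  assumes "p > 0"
  shows "padic_of_int p a \<in> padic_ints p"
  using assms by (auto simp: padic_ints_def padic_of_int_def mod_mod_cancel)

lemma padic_ints_mod:
  assumes "x \<in> padic_ints p" "m \<le> n"
  shows "x n mod int p ^ m = x m"
  using assms(2)
proof (induction n rule: dec_induct)
  case base
  then show ?case using assms(1) by (auto simp: padic_ints_def)
next
  case (step n)
  have "x (Suc n) mod int p ^ m = x (Suc n) mod int p ^ n mod int p ^ m"
    using step by (simp add: mod_mod_cancel le_imp_power_dvd)
  then show ?case using step assms(1) by (simp add: padic_ints_def)
qed

lemma padic_dist_le_iff:
  assumes p: "p > 1" and x: "x \<in> padic_ints p" and y: "y \<in> padic_ints p"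
  shows "padic_dist p x y \<le> 1 / real p ^ n \<longleftrightarrow> x n = y n"
proof -
  let ?z = "padic_diff p x y"
  have z0: "?z k = 0 \<longleftrightarrow> x k = y k" for k
  proof -
    have "x k mod int p ^ k = x k" "y k mod int p ^ k = y k"
      using x y by (auto simp: padic_ints_def)
    then show ?thesis
      unfolding padic_diff_def by (metis mod_eq_dvd_iff mod_eq_0_iff_dvd)
  qed
  have down: "x k = y k" if "x l = y l" "k \<le> l" for k l
    using padic_ints_mod[OF x that(2)] padic_ints_mod[OF y that(2)] that(1) by simp
  show ?thesis
  proof (cases "?z = (\<lambda>_. 0)")
    case True
    then have "?z n = 0" by simp
    then show ?thesis using z0 True by (simp add: padic_dist_def padic_norm_def)
  next
    case False
    define v where "v = padic_val ?z"
    from False obtain k where k: "?z k \<noteq> 0" by auto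
    have "x 0 = 0" "y 0 = 0"
      using x y by (auto simp: padic_ints_def dest!: spec[of _ 0])
    then have "k \<noteq> 0" using k z0[of k] by metis
    then obtain k' where "k = Suc k'" using not0_implies_Suc by blast
    then have v1: "?z (Suc v) \<noteq> 0"
      unfolding v_def padic_val_def using k by (intro LeastI_ex[of "\<lambda>n. ?z (Suc n) \<noteq> 0"]) blast
    have v2: "?z (Suc j) = 0" if "j < v" for j
      using not_less_Least[of j "\<lambda>n. ?z (Suc n) \<noteq> 0"] that unfolding v_def padic_val_def by blast
    have "x v = y v"
      using v2[of "v - 1"] z0[of v] \<open>x 0 = 0\<close> \<open>y 0 = 0\<close> by (cases v) auto
    then have "x n = y n \<longleftrightarrow> n \<le> v"
      using down[of v n] down[of n "Suc v"] v1 z0[of "Suc v"] by (meson not_less_eq_eq)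
    moreover have "padic_dist p x y = 1 / real p ^ v"
      using False by (simp add: padic_dist_def padic_norm_def v_def)
    moreover have "1 / real p ^ v \<le> 1 / real p ^ n \<longleftrightarrow> n \<le> v"
    proof -
      have "1 / real p ^ v \<le> 1 / real p ^ n \<longleftrightarrow> real p ^ n \<le> real p ^ v"
        using p by (simp add: divide_le_cancel frac_le_eq field_split_simps)
      then show ?thesis using p by simp
    qed
    ultimately show ?thesis by simp
  qed
qed

lemma padic_dist_cases:
  "padic_dist p x y = 0 \<or> (\<exists>n. padic_dist p x y = 1 / real p ^ n)"
  by (auto simp: padic_dist_def padic_norm_def)

lemma Metric_space_padic:
  assumes p: "p > 1"
  shows "Metric_space (padic_ints p) (padic_dist p)"
proof
  have nonneg: "0 \<le> padic_dist p x y" for x y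
    by (simp add: padic_dist_def padic_norm_def)
  have eq0: "x = y" if "x \<in> padic_ints p" "y \<in> padic_ints p" "padic_dist p x y = 0" for x y
    using padic_dist_le_iff[OF p that(1,2)] that(3) by auto
  have refl: "padic_dist p x x = 0" for x
    by (simp add: padic_dist_def padic_norm_def padic_diff_def)
  show "0 \<le> padic_dist p x y" for x y by (rule nonneg)
  show com: "padic_dist p x y = padic_dist p y x" for x y
  proof -
    have z: "padic_diff p x y n = 0 \<longleftrightarrow> padic_diff p y x n = 0" for x y n
      unfolding padic_diff_def by (metis dvd_minus_iff minus_diff_eq mod_eq_0_iff_dvd)
    then show ?thesis
      unfolding padic_dist_def padic_norm_def padic_val_def fun_eq_iff by simp
  qed
  show "padic_dist p x y = 0 \<longleftrightarrow> x = y" if "x \<in> padic_ints p" "y \<in> padic_ints p" for x y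
    using eq0[OF that] refl by auto
  show "padic_dist p x z \<le> padic_dist p x y + padic_dist p y z"
    if xyz: "x \<in> padic_ints p" "y \<in> padic_ints p" "z \<in> padic_ints p" for x y z
  proof (cases "padic_dist p x y \<le> padic_dist p y z")
    case True
    have "padic_dist p x z \<le> padic_dist p y z"
      using padic_dist_cases[of p y z]
    proof
      assume "padic_dist p y z = 0"
      then have "x = y" "y = z" using True eq0 xyz nonneg[of x y] by auto
      then show ?thesis by simp
    next
      assume "\<exists>n. padic_dist p y z = 1 / real p ^ n"
      then obtain n where n: "padic_dist p y z = 1 / real p ^ n" by blast
      then have "x n = y n" "y n = z n"
        using True padic_dist_le_iff[OF p] xyz by (metis order_refl)+
      then show ?thesis using padic_dist_le_iff[OF p xyz(1,3), of n] n by simp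
    qed
    then show ?thesis using nonneg[of x y] by simp
  next
    case False
    then have lt: "padic_dist p y z \<le> padic_dist p x y" "padic_dist p x y \<noteq> 0"
      using nonneg[of y z] by auto
    then obtain n where n: "padic_dist p x y = 1 / real p ^ n"
      using padic_dist_cases[of p x y] by auto
    then have "x n = y n" "y n = z n"
      using lt padic_dist_le_iff[OF p] xyz by (metis order_refl)+
    then have "padic_dist p x z \<le> padic_dist p x y"
      using padic_dist_le_iff[OF p xyz(1,3), of n] n by simp
    then show ?thesis using nonneg[of y z] by simp
  qed
qed

end

theory Submission imports Defs begin

text \<open>
  A ball of radius \<open>p ^ (-n)\<close> in the \<open>p\<close>-adic integers is a residue class modulo \<open>p ^ n\<close>, so the
  covering number of \<open>E\<close> at this scale is the number of residues of \<open>E\<close> modulo \<open>p ^ n\<close>. Take the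
  progressions of stage \<open>n\<close> to be the classes modulo \<open>p ^ n\<close> that meet \<open>E\<close>: they are nested, their
  number is controlled by the box dimension, and an integer lies in all the unions iff it is a
  \<open>p\<close>-adic limit of elements of \<open>E\<close>.
\<close>

definition residues_of :: "nat \<Rightarrow> int set \<Rightarrow> nat \<Rightarrow> int set" where
  "residues_of p E n = (\<lambda>a. a mod int p ^ n) ` E"

lemma finite_residues_of:
  assumes "p > 0"
  shows "finite (residues_of p E n)"
proof -
  have "residues_of p E n \<subseteq> {0..<int p ^ n}"
    using assms by (auto simp: residues_of_def)
  then show ?thesis by (rule finite_subset) simp
qed

text \<open>A residue modulo \<open>p ^ n\<close> determines the residue modulo every lower power,
  so a witness in \<open>E\<close> at level \<open>n\<close> also serves at level \<open>m\<close>.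
  This is what makes the stages nested.\<close>

lemma mod_in_residues_of_mono:
  assumes "x mod int p ^ n \<in> residues_of p E n" "m \<le> n"
  shows "x mod int p ^ m \<in> residues_of p E m"
proof -
  obtain a where a: "a \<in> E" "x mod int p ^ n = a mod int p ^ n"
    using assms(1) by (auto simp: residues_of_def)
  have "x mod int p ^ n mod int p ^ m = a mod int p ^ n mod int p ^ m"
    using a(2) by simp
  then have "x mod int p ^ m = a mod int p ^ m"
    using assms(2) by (simp add: mod_mod_cancel le_imp_power_dvd)
  then show ?thesis using a(1) by (auto simp: residues_of_def)
qed

lemma padic_mcball:
  assumes "p > 1" "c \<in> padic_ints p"
  shows "Metric_space.mcball (padic_ints p) (padic_dist p) c (1 / real p ^ n)
    = {y \<in> padic_ints p. y n = c n}"
  using assms padic_dist_le_iff[OF assms]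
  by (auto simp: Metric_space.mcball_def[OF Metric_space_padic])

text \<open>All points of a ball of this radius share their coordinate at \<open>n\<close>, so
  different residues of \<open>E\<close> need different balls.\<close>

lemma card_residues_of_le_covering_number:
  assumes p: "p > 1"
  shows "card (residues_of p E n)
    \<le> covering_number (padic_ints p) (padic_dist p) (1 / real p ^ n) (padic_of_int p ` E)"
proof -
  let ?M = "padic_ints p"
  let ?ball = "\<lambda>c. Metric_space.mcball ?M (padic_dist p) c (1 / real p ^ n)"
  let ?covers = "\<lambda>k. \<exists>\<B>. \<B> \<subseteq> ?ball ` ?M \<and> finite \<B> \<and> card \<B> = k \<and> padic_of_int p ` E \<subseteq> \<Union>\<B>"
  have mem: "padic_of_int p a \<in> ?M" for a
    using p by (intro padic_of_int_in_padic_ints) simp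
  \<comment> \<open>The \<open>LEAST\<close> in \<open>covering_number\<close> can be used only once
    some finite cover exists; balls centred at the residues themselves provide one.\<close>
  have "\<exists>k. ?covers k"
  proof (intro exI conjI)
    let ?B = "(\<lambda>r. ?ball (padic_of_int p r)) ` residues_of p E n"
    show "?B \<subseteq> ?ball ` ?M" using mem by auto
    show "finite ?B" using finite_residues_of p by simp
    show "card ?B = card ?B" ..
    show "padic_of_int p ` E \<subseteq> \<Union>?B"
      using mem by (auto simp: padic_mcball[OF p] residues_of_def padic_of_int_def)
  qed
  then have "?covers (covering_number ?M (padic_dist p) (1 / real p ^ n) (padic_of_int p ` E))"
    unfolding covering_number_def by (rule LeastI_ex)
  then obtain \<B> where \<B>: "\<B> \<subseteq> ?ball ` ?M" "finite \<B>" "padic_of_int p ` E \<subseteq> \<Union>\<B>"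
    "card \<B> = covering_number ?M (padic_dist p) (1 / real p ^ n) (padic_of_int p ` E)"
    by blast
  \<comment> \<open>The choice of the point in \<open>b\<close> is immaterial, since the coordinate
    at \<open>n\<close> is constant on a ball. Reading it off therefore recovers every residue from
    a ball of the cover.\<close>
  have "residues_of p E n \<subseteq> (\<lambda>b. (SOME y. y \<in> b) n) ` \<B>"
  proof
    fix r assume "r \<in> residues_of p E n"
    then obtain a where a: "a \<in> E" "r = padic_of_int p a n"
      by (auto simp: residues_of_def padic_of_int_def)
    then obtain b where b: "b \<in> \<B>" "padic_of_int p a \<in> b" using \<B>(3) by blast
    then obtain c where c: "c \<in> ?M" "b = {y \<in> ?M. y n = c n}"
      using \<B>(1) padic_mcball[OF p] by blast
    have "(SOME y. y \<in> b) \<in> b" by (rule someI[of "\<lambda>y. y \<in> b", OF b(2)])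
    then have "(SOME y. y \<in> b) n = r" using a(2) b(2) c(2) by simp
    then show "r \<in> (\<lambda>b. (SOME y. y \<in> b) n) ` \<B>" using b(1) by blast
  qed
  then have "card (residues_of p E n) \<le> card \<B>"
    using \<B>(2) by (meson surj_card_le)
  then show ?thesis using \<B>(4) by simp
qed

text \<open>Being within \<open>1 / p ^ n\<close> of an integer \<open>a\<close> means being
  congruent to \<open>a\<close> modulo \<open>p ^ n\<close>, and these radii become arbitrarily
  small.\<close>

lemma padic_of_int_in_closure_iff:
  assumes p: "p > 1"
  shows "padic_of_int p x \<in> padic_closure p E
    \<longleftrightarrow> (\<forall>n\<ge>1. x mod int p ^ n \<in> residues_of p E n)"
proof -
  interpret Metric_space "padic_ints p" "padic_dist p" by (rule Metric_space_padic[OF p])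
  have mem: "padic_of_int p a \<in> padic_ints p" for a
    using p by (intro padic_of_int_in_padic_ints) simp
  have close_iff: "padic_dist p (padic_of_int p x) (padic_of_int p a) \<le> 1 / real p ^ n
      \<longleftrightarrow> x mod int p ^ n = a mod int p ^ n" for a n
    using padic_dist_le_iff[OF p mem mem] by (simp add: padic_of_int_def)
  have "padic_of_int p x \<in> padic_closure p E \<longleftrightarrow>
      (\<forall>r>0. \<exists>a\<in>E. padic_dist p (padic_of_int p x) (padic_of_int p a) < r)"
    using mem by (auto simp: padic_closure_def metric_closure_of in_mball)
  also have "\<dots> \<longleftrightarrow> (\<forall>n\<ge>1. \<exists>a\<in>E. x mod int p ^ n = a mod int p ^ n)"
  proof (intro iffI allI impI)
    fix n :: nat
    assume "\<forall>r>0. \<exists>a\<in>E. padic_dist p (padic_of_int p x) (padic_of_int p a) < r"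
    moreover have "1 / real p ^ n > 0" using p by simp
    ultimately show "\<exists>a\<in>E. x mod int p ^ n = a mod int p ^ n"
      using close_iff by (meson less_imp_le)
  next
    fix r :: real
    assume res: "\<forall>n\<ge>1. \<exists>a\<in>E. x mod int p ^ n = a mod int p ^ n" and "r > 0"
    then obtain n where n: "(1 / real p) ^ n < r"
      using real_arch_pow_inv[of r "1 / real p"] p by auto
    \<comment> \<open>The exponent \<open>n\<close> just found may be 0, which \<open>res\<close>
      does not cover; passing to \<open>Suc n\<close> only shrinks the radius.\<close>
    have "1 / real p ^ Suc n \<le> 1 / real p ^ n"
      using p by (intro divide_left_mono power_increasing) auto
    moreover obtain a where a: "a \<in> E" "x mod int p ^ Suc n = a mod int p ^ Suc n"
      using res[rule_format, of "Suc n"] by auto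
    ultimately have "padic_dist p (padic_of_int p x) (padic_of_int p a) < r"
      using n close_iff[of a "Suc n"] by (simp add: power_one_over)
    then show "\<exists>a\<in>E. padic_dist p (padic_of_int p x) (padic_of_int p a) < r"
      using a(1) by blast
  qed
  finally show ?thesis by (auto simp: residues_of_def)
qed

text \<open>A limsup strictly below \<open>t\<close> forces the quotients eventually below
  \<open>t\<close>; clearing the denominator and exponentiating gives the bound.\<close>

lemma eventually_card_residues_of_le:
  assumes p: "p > 1" and dim: "box_dim p E < ereal t"
  shows "\<forall>\<^sub>F n in sequentially. real (card (residues_of p E n)) \<le> real p powr (real n * t)"
proof -
  let ?N = "\<lambda>n. covering_number (padic_ints p) (padic_dist p) (1 / real p ^ n) (padic_of_int p ` E)"
  have "\<forall>\<^sub>F n in sequentially. ereal (ln (real (?N n)) / (real n * ln (real p))) < ereal t"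
    using dim unfolding box_dim_def by (rule Limsup_lessD)
  then show ?thesis
    \<comment> \<open>Positivity of \<open>n\<close> makes the denominator \<open>n * ln p\<close>
      positive.\<close>
    using eventually_gt_at_top[of 0]
  proof eventually_elim
    case (elim n)
    have "real (?N n) \<le> real p powr (real n * t)"
    \<comment> \<open>As \<open>ln 0 = 0\<close>, exponentiating the logarithm would return 1 for an
      empty cover; in that case the bound is just nonnegativity of \<open>powr\<close>.\<close>
    proof (cases "?N n = 0")
      case False
      have "ln (real (?N n)) \<le> real n * t * ln (real p)"
        using elim p by (simp add: pos_divide_less_eq mult_ac)
      then have "exp (ln (real (?N n))) \<le> real p powr (real n * t)"
        using p by (simp add: powr_def)
      then show ?thesis using False by simp
    qed simp
    then show ?case
      using card_residues_of_le_covering_number[OF p, of E n] by linarith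
  qed
qed

lemma int_progression_eq_residue_class:
  fixes r q :: int
  assumes "r mod q = r"
  shows "{r + q * m | m. True} = {x. x mod q = r}"
proof -
  have "x = r + q * (x div q)" if "x mod q = r" for x
    using that by (metis mod_mult_div_eq)
  then show ?thesis using assms by auto
qed

text \<open>The ambient set \<open>T\<close> is all of \<open>\<int>\<close> for \<^const>\<open>S_padic\<close> and \<open>\<nat>\<close> for \<^const>\<open>S_padic_star\<close>.\<close>

lemma nested_progressions:
  fixes E T :: "int set"
  assumes p: "p > 1" and dim: "box_dim p E < ereal t"
    and E: "E = padic_of_int p -` padic_closure p E \<inter> T"
  shows "\<exists>(k :: nat \<Rightarrow> nat) (A :: nat \<Rightarrow> nat \<Rightarrow> int set).
    (\<forall>n\<ge>1. \<forall>i\<in>{1..k n}. \<exists>a. A n i = {a + int p ^ n * m | m. True} \<inter> T) \<and>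
    (\<forall>\<^sub>F n in sequentially. real (k n) \<le> real p powr (real n * t)) \<and>
    (\<forall>n\<ge>1. E \<subseteq> (\<Union>i\<in>{1..k n}. A n i)) \<and>
    (\<forall>n\<ge>1. (\<Union>i\<in>{1..k (n + 1)}. A (n + 1) i) \<subseteq> (\<Union>i\<in>{1..k n}. A n i)) \<and>
    E = (\<Inter>n\<in>{1..}. \<Union>i\<in>{1..k n}. A n i)"
proof -
  define k where "k n = card (residues_of p E n)" for n
  \<comment> \<open>The residues are numbered from 1 to match the indexing of the progressions; for
    empty \<open>E\<close> there are none and every union is empty.\<close>
  have "\<exists>e. bij_betw e {1..k n} (residues_of p E n)" for n
    unfolding k_def using p finite_residues_of[of p E n] ex_bij_betw_nat_finite_1 by simp
  then obtain e where e: "\<And>n. bij_betw (e n) {1..k n} (residues_of p E n)" by metis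
  define A where "A n i = {e n i + int p ^ n * m | m. True} \<inter> T" for n i
  have A: "A n i = {x \<in> T. x mod int p ^ n = e n i}" if "i \<in> {1..k n}" for n i
  proof -
    have "e n i \<in> residues_of p E n" using bij_betwE[OF e] that by blast
    then have "e n i mod int p ^ n = e n i" by (auto simp: residues_of_def)
    from int_progression_eq_residue_class[OF this] show ?thesis by (auto simp: A_def)
  qed
  have Un: "(\<Union>i\<in>{1..k n}. A n i) = {x \<in> T. x mod int p ^ n \<in> residues_of p E n}" for n
    using A[of _ n] unfolding bij_betw_imp_surj_on[OF e[of n], symmetric] by auto
  \<comment> \<open>This is the closedness hypothesis on \<open>E\<close> rewritten as congruence
    conditions; by \<open>Un\<close>, its right-hand side is membership in all the unions.\<close>
  have E_iff: "x \<in> E \<longleftrightarrow> x \<in> T \<and> (\<forall>n\<ge>1. x mod int p ^ n \<in> residues_of p E n)" for x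
    using E padic_of_int_in_closure_iff[OF p] by blast
  show ?thesis
  proof (intro exI[of _ k] exI[of _ A] conjI allI impI ballI)
    show "\<exists>a. A n i = {a + int p ^ n * m | m. True} \<inter> T" for n i
      by (auto simp: A_def)
    show "\<forall>\<^sub>F n in sequentially. real (k n) \<le> real p powr (real n * t)"
      unfolding k_def using p dim by (rule eventually_card_residues_of_le)
    show "E \<subseteq> (\<Union>i\<in>{1..k n}. A n i)" for n
      unfolding Un residues_of_def using E_iff by blast
    show "(\<Union>i\<in>{1..k (n + 1)}. A (n + 1) i) \<subseteq> (\<Union>i\<in>{1..k n}. A n i)" for n
      unfolding Un using mod_in_residues_of_mono[OF _ le_add1[of n 1]] by blast
    show "E = (\<Inter>n\<in>{1..}. \<Union>i\<in>{1..k n}. A n i)"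
      unfolding Un using E_iff by auto
  qed
qed

theorem theoremF:
  fixes p :: nat and E :: "int set" and s \<delta> :: real
  assumes "prime p" and "box_dim p E = ereal s" and "\<delta> > 0"
  shows "(E \<in> S_padic p \<longrightarrow>
      (\<exists>(k :: nat \<Rightarrow> nat) (A :: nat \<Rightarrow> nat \<Rightarrow> int set).
        (\<forall>n\<ge>1. \<forall>i\<in>{1..k n}. arith_prog_int (int p ^ n) (A n i)) \<and>
        (\<forall>\<^sub>F n in sequentially. real (k n) \<le> real p powr (real n * (s + \<delta>))) \<and>
        (\<forall>n\<ge>1. E \<subseteq> (\<Union>i\<in>{1..k n}. A n i)) \<and>
        (\<forall>n\<ge>1. (\<Union>i\<in>{1..k (n + 1)}. A (n + 1) i) \<subseteq> (\<Union>i\<in>{1..k n}. A n i)) \<and>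
        E = (\<Inter>n\<in>{1..}. \<Union>i\<in>{1..k n}. A n i))) \<and>
    (E \<in> S_padic_star p \<longrightarrow>
      (\<exists>(k :: nat \<Rightarrow> nat) (A :: nat \<Rightarrow> nat \<Rightarrow> int set).
        (\<forall>n\<ge>1. \<forall>i\<in>{1..k n}. arith_prog_nat (int p ^ n) (A n i)) \<and>
        (\<forall>\<^sub>F n in sequentially. real (k n) \<le> real p powr (real n * (s + \<delta>))) \<and>
        (\<forall>n\<ge>1. E \<subseteq> (\<Union>i\<in>{1..k n}. A n i)) \<and>
        (\<forall>n\<ge>1. (\<Union>i\<in>{1..k (n + 1)}. A (n + 1) i) \<subseteq> (\<Union>i\<in>{1..k n}. A n i)) \<and>
        E = (\<Inter>n\<in>{1..}. \<Union>i\<in>{1..k n}. A n i)))"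
  (is "(_ \<longrightarrow> ?int_progressions) \<and> (_ \<longrightarrow> ?nat_progressions)")
proof -
  have p: "p > 1" using assms(1) by (rule prime_gt_1_nat)
  \<comment> \<open>The margin \<open>\<delta>\<close> supplies the strict inequality that turns the
    limsup into an eventual bound.\<close>
  have dim: "box_dim p E < ereal (s + \<delta>)" using assms(2,3) by simp
  show ?thesis
  proof (intro conjI impI)
    assume "E \<in> S_padic p"
    then have "E = padic_of_int p -` padic_closure p E \<inter> UNIV" by (simp add: S_padic_def)
    from nested_progressions[OF p dim this] show ?int_progressions
      unfolding arith_prog_int_def Int_UNIV_right .
  next
    assume "E \<in> S_padic_star p"
    then have "E = padic_of_int p -` padic_closure p E \<inter> {1..}" by (simp add: S_padic_star_def)
    from nested_progressions[OF p dim this] show ?nat_progressions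
      unfolding arith_prog_nat_def .
  qed
qed

end
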